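(* (Mean hitting time formula in terms of the minimal polynomial) Let $\Phi$ be a finite ergodic open quantum random walk with degree of freedom $n\ge 2$ and $k\ge 2$ sites, and let $\hat K=(\hat k_{ij})$ be its mean hitting time operator. Let $\hat D=\mathrm{diag}(\hat k_{11},\dots,\hat k_{kk})$ be the block-diagonal operator with diagonal entries $\hat k_{ii}$ and let $\hat N:=\hat K-\hat D$. Let $p(x)$ be the minimal polynomial of $\Phi$, write $p(x)=(x-1)f(x)$, let $r$ be the degree of $f$, and write $f(x)=a_0x^r+a_1x^{r-1}+\cdots+a_{r-1}x+a_r$ with $a_0=1$. Then for every density matrix $\rho\in M_n(\mathbb C)$ and all $i,j=1,\dots,k$, $$\mathrm{Tr}(\hat N_{ij}\rho)=\mathrm{Tr}\Big[\sum_{s=0}^\infty\Big((\hat D\hat\Phi^s)_{ii}-(\hat D\hat\Phi^s)_{ij}\Big)\rho\Big]$$ and $$\sum_{s=0}^\infty\Big((\hat D\hat\Phi^s)_{ii}-(\hat D\hat\Phi^s)_{ij}\Big)=\frac{1}{f(1)}\sum_{s=0}^{r-1}\sum_{l=0}^{r-s-1}a_l\Big((\hat D\hat\Phi^s)_{ii}-(\hat D\hat\Phi^s)_{ij}\Big).$$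
   Context: OQW. Let $k$ (number of sites) and $n$ (degree of freedom) be positive integers. A finite open quantum random walk (OQW) $\Phi$ is given by matrices $B_{ij}\in M_n(\mathbb C)$, $i,j=1,\dots,k$, with $\sum_{i=1}^k B_{ij}^*B_{ij}=I$ for each $j$; $B_{ij}$ is the effect of passing from site $j$ to site $i$. For $C\in M_n(\mathbb C)$ let $M_C:M_n(\mathbb C)\to M_n(\mathbb C)$, $M_C(X)=CXC^*$. Block operators. A block operator is a $k\times k$ array $\hat A=(\hat A_{ij})$ of linear maps $\hat A_{ij}:M_n(\mathbb C)\to M_n(\mathbb C)$, acting on column vectors in $M_n(\mathbb C)^k$; products are block matrix products, $(\hat A\hat B)_{ij}=\sum_{l}\hat A_{il}\hat B_{lj}$ (composition of maps). $\hat A_{ij}\rho$ denotes $\hat A_{ij}(\rho)$. The block representation of $\Phi$ is $\hat\Phi=(\hat\Phi_{ij})$, $\hat\Phi_{ij}=M_{B_{ij}}$. The matrix representation $[\Phi]$ is the $kn^2\times kn^2$ matrix with blocks $B_{ij}\otimes\overline{B_{ij}}$, i.e. the matrix of $\hat\Phi$ under row-stacking vectorization. Minimal polynomial. The minimal polynomial of $\Phi$ is the monic polynomial $p$ of least degree with $p([\Phi])=0$ (equivalently $p(\hat\Phi)=0$). Since $1$ is an eigenvalue of multiplicity $1$ for ergodic $\Phi$, $p(x)=(x-1)f(x)$ with $f$ monic. Ergodicity. $\hat\Omega$ is the block operator all of whose blocks $\hat\Omega_{pq}$, $p,q=1,\dots,k$, are equal to $X\mapsto\frac{1}{kn}\mathrm{Tr}(X)I_n$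 (with respect to row-stacking vectorization, its matrix is $\frac1{kn}\sum_{a,b=1}^nE_{ab}\otimes E_{ab}$ with $E_{ab}\in M_n(\mathbb C)$ the matrix units). $\Phi$ is called ergodic if $\hat\Phi^r\to\hat\Omega$ as $r\to\infty$ (entrywise convergence of matrix representations). Mean hitting time operator. For $r\ge1$ let $\pi(i\leftarrow j;r)$ be the collection of products $C=B_{i_r i_{r-1}}\cdots B_{i_2i_1}B_{i_1i_0}$, one for each sequence of sites with $i_0=j$, $i_r=i$ and $i_1,\dots,i_{r-1}\neq i$ (first visit to $i$ after time $0$ at step $r$; for $i=j$, first return). Then $\hat K=(\hat k_{ij})_{i,j=1}^k$ with $\hat k_{ij}:=\sum_{r\ge1} r\sum_{C\in\pi(i\leftarrow j;r)}M_C$. A density matrix is a positive semidefinite $\rho\in M_n(\mathbb C)$ with $\mathrm{Tr}(\rho)=1$. *)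

theory Defs
  imports "HOL-Analysis.Analysis" "HOL-Computational_Algebra.Polynomial"
begin

section \<open>Complex matrices\<close>

text \<open>The sites are the elements of a finite type \<open>'k\<close> (so \<open>k = CARD('k)\<close>), and \<open>M_n(\<complex>)\<close> is
  \<open>complex^'n^'n\<close> (so \<open>n = CARD('n)\<close>).  On this type the class operations \<open>*\<close> and \<open>^\<close> act
  componentwise, and only real scalars are available through \<open>*\<^sub>R\<close>; therefore the matrix product is
  always \<open>**\<close>, and scaling by a complex number and matrix powers are defined here.\<close>

definition cscale :: "complex \<Rightarrow> complex^'n^'m \<Rightarrow> complex^'n^'m" where
  "cscale c X = (\<chi> a b. c * X $ a $ b)"

definition cadjoint :: "complex^'n^'m \<Rightarrow> complex^'m^'n" where
  "cadjoint C = (\<chi> a b. cnj (C $ b $ a))"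

definition density_matrix :: "complex^'n^'n \<Rightarrow> bool" where
  "density_matrix \<rho> \<longleftrightarrow>
     cadjoint \<rho> = \<rho> \<and>
     (\<forall>v. 0 \<le> Re (\<Sum>a\<in>UNIV. \<Sum>b\<in>UNIV. cnj (v $ a) * \<rho> $ a $ b * v $ b)) \<and>
     trace \<rho> = 1"

primrec matrix_power :: "complex^'m^'m \<Rightarrow> nat \<Rightarrow> complex^'m^'m" where
  "matrix_power A 0 = mat 1"
| "matrix_power A (Suc m) = A ** matrix_power A m"

definition matrix_poly :: "complex poly \<Rightarrow> complex^'m^'m \<Rightarrow> complex^'m^'m" where
  "matrix_poly p A = (\<Sum>m\<le>degree p. cscale (coeff p m) (matrix_power A m))"

definition is_minimal_polynomial :: "complex poly \<Rightarrow> complex^'m^'m \<Rightarrow> bool" where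
  "is_minimal_polynomial p A \<longleftrightarrow>
     lead_coeff p = 1 \<and> matrix_poly p A = 0 \<and>
     (\<forall>q. lead_coeff q = 1 \<and> matrix_poly q A = 0 \<longrightarrow> degree p \<le> degree q)"

section \<open>Block operators\<close>

type_synonym ('k, 'n) block_op = "'k \<Rightarrow> 'k \<Rightarrow> complex^'n^'n \<Rightarrow> complex^'n^'n"

definition block_id :: "('k, 'n::finite) block_op" where
  "block_id i j = (\<lambda>X. if i = j then X else 0)"

definition block_mult ::
    "('k::finite, 'n::finite) block_op \<Rightarrow> ('k, 'n) block_op \<Rightarrow> ('k, 'n) block_op" where
  "block_mult A B i j = (\<lambda>X. \<Sum>l\<in>UNIV. A i l (B l j X))"

primrec block_power :: "('k::finite, 'n::finite) block_op \<Rightarrow> nat \<Rightarrow> ('k, 'n) block_op" where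
  "block_power A 0 = block_id"
| "block_power A (Suc m) = block_mult A (block_power A m)"

definition block_diff ::
    "('k, 'n::finite) block_op \<Rightarrow> ('k, 'n) block_op \<Rightarrow> ('k, 'n) block_op" where
  "block_diff A B i j = (\<lambda>X. A i j X - B i j X)"

definition block_diag :: "('k \<Rightarrow> complex^'n^'n \<Rightarrow> complex^'n^'n) \<Rightarrow> ('k, 'n::finite) block_op" where
  "block_diag d i j = (\<lambda>X. if i = j then d i X else 0)"

text \<open>The matrix of a block operator under row-stacking vectorization: the coordinate \<open>(i, a, b)\<close>
  of a column vector in \<open>M_n(\<complex>)\<^sup>k\<close> is the entry \<open>(a, b)\<close> of its \<open>i\<close>-th component, and column
  \<open>(j, c, d)\<close> is obtained by applying the operator to the matrix unit \<open>E_cd\<close> placed at site \<open>j\<close>.\<close>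

definition block_matrix ::
    "('k::finite, 'n::finite) block_op \<Rightarrow> complex^('k \<times> 'n \<times> 'n)^('k \<times> 'n \<times> 'n)" where
  "block_matrix A = (\<chi> u v. case (u, v) of ((i, a, b), (j, c, d)) \<Rightarrow>
     A i j (\<chi> a' b'. if a' = c \<and> b' = d then 1 else 0) $ a $ b)"

section \<open>Open quantum random walks\<close>

definition is_oqw :: "('k::finite \<Rightarrow> 'k \<Rightarrow> complex^'n^'n) \<Rightarrow> bool" where
  "is_oqw B \<longleftrightarrow> (\<forall>j. (\<Sum>i\<in>UNIV. cadjoint (B i j) ** B i j) = mat 1)"

definition conj_map :: "complex^'n^'n \<Rightarrow> complex^'n^'n \<Rightarrow> complex^'n^'n" where
  "conj_map C = (\<lambda>X. C ** X ** cadjoint C)"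

definition oqw_block :: "('k \<Rightarrow> 'k \<Rightarrow> complex^'n^'n) \<Rightarrow> ('k, 'n::finite) block_op" where
  "oqw_block B i j = conj_map (B i j)"

text \<open>Block \<open>(i, j)\<close> is the Kronecker product of \<open>B i j\<close> with its entrywise conjugate.\<close>

definition oqw_matrix ::
    "('k::finite \<Rightarrow> 'k \<Rightarrow> complex^'n::finite^'n) \<Rightarrow> complex^('k \<times> 'n \<times> 'n)^('k \<times> 'n \<times> 'n)" where
  "oqw_matrix B = (\<chi> u v. case (u, v) of ((i, a, b), (j, c, d)) \<Rightarrow>
     B i j $ a $ c * cnj (B i j $ b $ d))"

lemma block_matrix_oqw_block: "block_matrix (oqw_block B) = oqw_matrix B"
proof -
  have "conj_map C (\<chi> a' b'. if a' = c \<and> b' = d then 1 else 0) $ a $ b = C $ a $ c * cnj (C $ b $ d)"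
    for C :: "complex^'b::finite^'b" and a b c d
  proof -
    have "(C ** (\<chi> a' b'. if a' = c \<and> b' = d then 1 else 0)) $ a $ e = (if e = d then C $ a $ c else 0)" for e
      by (auto simp: matrix_matrix_mult_def if_distrib cong: if_cong)
    then show ?thesis
      by (simp add: conj_map_def cadjoint_def matrix_matrix_mult_def[of "C ** _"]
          if_distrib[of "\<lambda>x. x * _"] cong: if_cong)
  qed
  then show ?thesis
    by (auto simp: vec_eq_iff block_matrix_def oqw_matrix_def oqw_block_def)
qed

definition block_Omega :: "('k::finite, 'n::finite) block_op" where
  "block_Omega p q = (\<lambda>X. cscale (1 / of_nat (CARD('k) * CARD('n)) * trace X) (mat 1))"

definition ergodic_oqw :: "('k::finite \<Rightarrow> 'k \<Rightarrow> complex^'n::finite^'n) \<Rightarrow> bool" where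
  "ergodic_oqw B \<longleftrightarrow>
     (\<forall>u v. (\<lambda>r. block_matrix (block_power (oqw_block B) r) $ u $ v)
              \<longlonglongrightarrow> block_matrix (block_Omega :: ('k, 'n) block_op) $ u $ v)"

section \<open>Mean hitting times\<close>

text \<open>A sequence of sites \<open>i\<^sub>0, \<dots>, i\<^sub>r\<close> is the list of its entries, in this order.\<close>

definition first_visits :: "'k \<Rightarrow> 'k \<Rightarrow> nat \<Rightarrow> 'k list set" where
  "first_visits i j r =
     {w. length w = Suc r \<and> w ! 0 = j \<and> w ! r = i \<and> (\<forall>m. 0 < m \<and> m < r \<longrightarrow> w ! m \<noteq> i)}"

fun path_product :: "('k \<Rightarrow> 'k \<Rightarrow> complex^'n^'n) \<Rightarrow> 'k list \<Rightarrow> complex^'n^'n" where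
  "path_product B (x # y # w) = path_product B (y # w) ** B y x"
| "path_product B _ = mat 1"

text \<open>The collection \<open>\<pi>(i \<leftarrow> j; r)\<close> has one product for each sequence, so the sum runs over
  sequences and coinciding products are counted repeatedly.  The series over \<open>r \<ge> 1\<close> is shifted to
  start at 0 and is taken pointwise, which in finite dimension agrees with convergence of linear
  maps.\<close>

definition mean_hitting_time ::
    "('k::finite \<Rightarrow> 'k \<Rightarrow> complex^'n::finite^'n) \<Rightarrow> ('k, 'n) block_op" where
  "mean_hitting_time B i j = (\<lambda>X. \<Sum>r. of_nat (Suc r) *\<^sub>R
     (\<Sum>w\<in>first_visits i j (Suc r). conj_map (path_product B w) X))"

end

theory Submission
  imports Defs
begin

text \<open>Fix a site \<open>i\<close>, let \<open>S\<close> be one step of the walk followed by deleting the component at \<open>i\<close>, and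
  let \<open>H v = \<Sum>r. (r + 1) (\<Phi> S^r v)_i\<close>, so that \<open>k_ij X\<close> is \<open>H\<close> applied to \<open>X\<close> placed at site \<open>j\<close>.
  By ergodicity some power of \<open>S\<close> contracts the trace of positive vectors, so these series converge.
  Shifting the index shows that \<open>H v - H (S v)\<close> has the trace of \<open>v\<close>.  As \<open>S v\<close> is \<open>\<Phi> v\<close> minus its
  component at \<open>i\<close>, summing this along the orbit of the traceless vector \<open>x = X e_i - X e_j\<close>
  telescopes, and \<open>\<Phi>^s x\<close> tends to 0, which gives the trace formula.

  For the second formula, \<open>f(\<Phi>) x\<close> is fixed by \<open>\<Phi>\<close> and hence equal to its limit
  \<open>f(\<Phi>) \<Omega> x = 0\<close>.  Dividing \<open>f(1) - f(z)\<close> by \<open>1 - z\<close> then writes \<open>f(1) x\<close> as \<open>(1 - \<Phi>) w\<close> with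
  \<open>w = \<Sum>s<r. \<Sum>l<r-s. a_l \<Phi>^s x\<close>, and the Neumann series of \<open>\<Phi>\<close> telescopes on this vector.\<close>

section \<open>Minimal polynomial and orbit sums\<close>

lemma cscale_nth [simp]: "cscale c X $ a $ b = c * X $ a $ b"
  by (simp add: cscale_def)

lemma cscale_simps [simp]: "cscale 0 X = 0" "cscale c 0 = 0" "cscale 1 X = X"
  by (simp_all add: vec_eq_iff)

lemma cscale_add_left: "cscale (c + d) X = cscale c X + cscale d X"
  by (simp add: vec_eq_iff algebra_simps)

lemma cscale_diff_left: "cscale (c - d) X = cscale c X - cscale d X"
  by (simp add: vec_eq_iff algebra_simps)

lemma matrix_mul_cscale: "A ** cscale c X = cscale c (A ** X)"
  by (simp add: vec_eq_iff matrix_matrix_mult_def sum_distrib_left mult.left_commute)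

lemma cscale_matrix_mul: "cscale c X ** A = cscale c (X ** A)"
  by (simp add: vec_eq_iff matrix_matrix_mult_def sum_distrib_left mult.assoc)

lemma cscale_vector_mul: "cscale c X *v v = c *s (X *v v)"
  by (simp add: vec_eq_iff matrix_vector_mult_def sum_distrib_left mult.assoc)

lemma matrix_matrix_mul_add_left:
  fixes A :: "'a::semiring_1^'n^'m"
  shows "(A + B) ** C = A ** C + B ** C"
  by (simp add: vec_eq_iff matrix_matrix_mult_def distrib_right sum.distrib)

lemma matrix_matrix_mul_diff_right:
  fixes A :: "'a::ring_1^'n^'m"
  shows "A ** (B - C) = A ** B - A ** C"
  by (simp add: vec_eq_iff matrix_matrix_mult_def right_diff_distrib sum_subtractf)

lemma matrix_mul_sum_right:
  fixes A :: "'a::semiring_1^'n^'m"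
  shows "A ** (\<Sum>i\<in>I. X i) = (\<Sum>i\<in>I. A ** X i)"
  by (induction I rule: infinite_finite_induct) (simp_all add: matrix_add_ldistrib)

lemma matrix_mul_sum_left:
  fixes A :: "'a::semiring_1^'n^'m"
  shows "(\<Sum>i\<in>I. X i) ** A = (\<Sum>i\<in>I. X i ** A)"
  by (induction I rule: infinite_finite_induct) (simp_all add: matrix_matrix_mul_add_left)

lemma sum_matrix_vector_mul:
  fixes X :: "'i \<Rightarrow> 'a::semiring_1^'n^'m"
  shows "(\<Sum>i\<in>I. X i) *v v = (\<Sum>i\<in>I. X i *v v)"
  by (induction I rule: infinite_finite_induct) (simp_all add: matrix_vector_mult_add_rdistrib)

lemma matrix_vector_mul_sum:
  fixes A :: "'a::semiring_1^'n^'m"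
  shows "A *v (\<Sum>i\<in>I. v i) = (\<Sum>i\<in>I. A *v v i)"
  by (induction I rule: infinite_finite_induct) (simp_all add: matrix_vector_right_distrib)

lemma matrix_power_commute: "A ** matrix_power A m = matrix_power A m ** A"
  by (induction m) (simp_all add: matrix_mul_assoc)

lemma tendsto_matrix_mul_left:
  fixes X :: "'i \<Rightarrow> complex^'n^'m"
  assumes "(X \<longlongrightarrow> Y) F"
  shows "((\<lambda>i. X i ** A) \<longlongrightarrow> Y ** A) F"
  unfolding matrix_matrix_mult_def using assms by (intro tendsto_intros)

lemma tendsto_matrix_vector_mul_left:
  fixes X :: "'i \<Rightarrow> complex^'n^'m"
  assumes "(X \<longlongrightarrow> Y) F"
  shows "((\<lambda>i. X i *v v) \<longlongrightarrow> Y *v v) F"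
  unfolding matrix_vector_mult_def using assms by (intro tendsto_intros)

lemma tendsto_matrix_vector_mul_right:
  fixes v :: "'i \<Rightarrow> complex^'n"
  assumes "(v \<longlongrightarrow> w) F"
  shows "((\<lambda>i. A *v v i) \<longlongrightarrow> A *v w) F"
  unfolding matrix_vector_mult_def using assms by (intro tendsto_intros)

section \<open>Polynomials evaluated at a matrix\<close>

lemma matrix_poly_eq_sum:
  assumes "degree p \<le> d"
  shows "matrix_poly p A = (\<Sum>m\<le>d. cscale (coeff p m) (matrix_power A m))"
  unfolding matrix_poly_def
  by (rule sum.mono_neutral_left) (use assms in \<open>auto simp: coeff_eq_0\<close>)

lemma matrix_poly_diff: "matrix_poly (p - q) A = matrix_poly p A - matrix_poly q A"
proof -
  define d where "d = max (degree p) (degree q)"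
  have "degree (p - q) \<le> d" "degree p \<le> d" "degree q \<le> d"
    by (auto simp: d_def degree_diff_le)
  then show ?thesis
    by (simp add: matrix_poly_eq_sum[of _ d] cscale_diff_left sum_subtractf)
qed

lemma matrix_poly_add: "matrix_poly (p + q) A = matrix_poly p A + matrix_poly q A"
proof -
  define d where "d = max (degree p) (degree q)"
  have "degree (p + q) \<le> d" "degree p \<le> d" "degree q \<le> d"
    by (auto simp: d_def degree_add_le)
  then show ?thesis
    by (simp add: matrix_poly_eq_sum[of _ d] cscale_add_left sum.distrib)
qed

lemma matrix_poly_0 [simp]: "matrix_poly 0 A = 0"
  by (simp add: matrix_poly_def)

lemma matrix_poly_sum: "matrix_poly (\<Sum>i\<in>I. p i) A = (\<Sum>i\<in>I. matrix_poly (p i) A)"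
  by (induction I rule: infinite_finite_induct) (simp_all add: matrix_poly_add)

lemma matrix_poly_monom: "matrix_poly (monom c m) A = cscale c (matrix_power A m)"
  by (simp add: matrix_poly_eq_sum[OF degree_monom_le] coeff_monom if_distrib
      if_distribR cong: if_cong)

lemma matrix_poly_pCons_0: "matrix_poly (pCons 0 q) A = A ** matrix_poly q A"
proof -
  have "matrix_poly (pCons 0 q) A
      = (\<Sum>m\<le>Suc (degree q). cscale (coeff (pCons 0 q) m) (matrix_power A m))"
    by (rule matrix_poly_eq_sum) (simp add: degree_pCons_le)
  then show ?thesis
    by (simp add: matrix_poly_def sum.atMost_Suc_shift matrix_mul_sum_right matrix_mul_cscale
        del: sum.atMost_Suc degree_pCons_eq_if)
qed

text \<open>Products with \<open>x - 1\<close> are the only polynomial products used below, so a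
  shift and a difference stand in for general multiplicativity.\<close>

lemma matrix_poly_x_minus_1: "matrix_poly ([:-1, 1:] * q) A = A ** matrix_poly q A - matrix_poly q A"
proof -
  have "[:-1, 1:] * q = pCons 0 q - q"
    by simp
  then show ?thesis
    by (simp only: matrix_poly_diff matrix_poly_pCons_0)
qed

lemma matrix_poly_commute: "A ** matrix_poly p A = matrix_poly p A ** A"
  by (simp add: matrix_poly_def matrix_mul_sum_right matrix_mul_sum_left matrix_mul_cscale
      cscale_matrix_mul matrix_power_commute)

lemma matrix_power_poly_commute:
  "matrix_power A m ** matrix_poly p A = matrix_poly p A ** matrix_power A m"
proof (induction m)
  case (Suc m)
  have "matrix_power A (Suc m) ** matrix_poly p A = A ** (matrix_power A m ** matrix_poly p A)"
    by (simp add: matrix_mul_assoc)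
  also have "\<dots> = (A ** matrix_poly p A) ** matrix_power A m"
    by (simp only: Suc.IH matrix_mul_assoc)
  finally show ?case
    by (simp add: matrix_poly_commute matrix_mul_assoc[symmetric])
qed simp

lemma matrix_power_fixes:
  assumes "A ** Y = Y"
  shows "matrix_power A m ** Y = Y"
  using assms by (induction m) (simp_all add: matrix_mul_assoc[symmetric])

text \<open>A double root would mean a Jordan block at 1, which convergent powers exclude. With f =
  (x - 1) h, the matrix f(A) is fixed by A and so equals A^(m+1) h(A) - A^m h(A) for every m; this
  tends to 0. Then f annihilates A although its degree is below that of p.\<close>

lemma minimal_polynomial_simple_root_1:
  assumes lim: "matrix_power A \<longlonglongrightarrow> W"
    and p: "is_minimal_polynomial p A" and p_f: "p = [:-1, 1:] * f"
  shows "poly f 1 \<noteq> 0"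
proof
  assume "poly f 1 = 0"
  then obtain h where h: "f = [:-1, 1:] * h"
    by (metis poly_eq_0_iff_dvd dvdE)
  define H where "H = matrix_poly h A"
  have monic: "lead_coeff p = 1" and "matrix_poly p A = 0"
    using p by (auto simp: is_minimal_polynomial_def)
  then have fixed: "A ** matrix_poly f A = matrix_poly f A"
    using p_f by (simp only: matrix_poly_x_minus_1) simp
  have "matrix_poly f A = matrix_power A (Suc m) ** H - matrix_power A m ** H" for m
  proof -
    have "matrix_poly f A = matrix_power A m ** (A ** H - H)"
      using matrix_power_fixes[OF fixed, of m] by (simp only: h matrix_poly_x_minus_1 H_def)
    also have "\<dots> = matrix_power A (Suc m) ** H - matrix_power A m ** H"
      by (simp add: matrix_power_commute matrix_mul_assoc matrix_matrix_mul_diff_right)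
    finally show ?thesis .
  qed
  moreover have "(\<lambda>m. matrix_power A (Suc m) ** H - matrix_power A m ** H)
      \<longlonglongrightarrow> W ** H - W ** H"
    by (intro tendsto_diff tendsto_matrix_mul_left LIMSEQ_Suc lim)
  ultimately have "matrix_poly f A = 0"
    by (metis (no_types, lifting) LIMSEQ_unique diff_self tendsto_const tendsto_cong[OF always_eventually])
  moreover have "lead_coeff f = 1"
    using monic unfolding p_f lead_coeff_mult by simp
  ultimately have "degree p \<le> degree f"
    using p by (auto simp: is_minimal_polynomial_def)
  moreover have "f \<noteq> 0"
    using \<open>lead_coeff f = 1\<close> by auto
  then have "degree p = Suc (degree f)"
    unfolding p_f by (subst degree_mult_eq) auto
  ultimately show False
    by simp
qed

lemma orbit_sums_minimal_polynomial:
  fixes A :: "complex^'m^'m"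
  assumes lim: "matrix_power A \<longlonglongrightarrow> W"
    and p: "is_minimal_polynomial p A" and p_f: "p = [:-1, 1:] * f"
    and f: "f = (\<Sum>l\<le>r. monom (a l) (r - l))"
    and v: "W *v v = 0"
  shows "(\<lambda>s. matrix_power A s *v v) sums
    ((1 / poly f 1) *s (\<Sum>s<r. \<Sum>l<r - s. a l *s (matrix_power A s *v v)))"
proof -
  let ?V = "\<lambda>s. matrix_power A s *v v"
  define w where "w = (\<Sum>s<r. \<Sum>l<r - s. a l *s ?V s)"
  have "matrix_poly p A = 0"
    using p by (auto simp: is_minimal_polynomial_def)
  then have fixed: "A ** matrix_poly f A = matrix_poly f A"
    unfolding p_f matrix_poly_x_minus_1 by simp
  \<comment> \<open>Constant along the orbit because A fixes f(A). The orbit tends to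
    \<open>W *v v = 0\<close>, so the constant is 0.\<close>
  have "matrix_poly f A *v ?V m = matrix_poly f A *v v" for m
    using matrix_power_fixes[OF fixed, of m]
    by (simp add: matrix_vector_mul_assoc flip: matrix_power_poly_commute)
  moreover have "(\<lambda>m. matrix_poly f A *v ?V m) \<longlonglongrightarrow> matrix_poly f A *v (W *v v)"
    by (intro tendsto_matrix_vector_mul_right tendsto_matrix_vector_mul_left lim)
  ultimately have "matrix_poly f A *v v = 0"
    using v by (simp add: LIMSEQ_const_iff)
  moreover have "matrix_poly f A *v v = (\<Sum>l\<le>r. a l *s ?V (r - l))"
    unfolding f by (simp add: matrix_poly_sum matrix_poly_monom sum_matrix_vector_mul cscale_vector_mul)
  ultimately have fv: "(\<Sum>l\<le>r. a l *s ?V (r - l)) = 0"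
    by simp
  have f1: "poly f 1 = (\<Sum>l\<le>r. a l)"
    unfolding f by (simp add: poly_sum poly_monom)
  have AV: "A *v ?V s = ?V (Suc s)" for s
    by (simp add: matrix_vector_mul_assoc)
  \<comment> \<open>With \<open>l\<close> outermost, each inner sum runs over an initial piece of
    the orbit and telescopes under 1 - A.\<close>
  have w_swap: "w = (\<Sum>l\<le>r. \<Sum>s<r - l. a l *s ?V s)"
  proof -
    have "w = (\<Sum>(s, l)\<in>Sigma {..<r} (\<lambda>s. {..<r - s}). a l *s ?V s)"
      by (simp add: w_def sum.Sigma)
    also have "\<dots> = (\<Sum>(l, s)\<in>Sigma {..r} (\<lambda>l. {..<r - l}). a l *s ?V s)"
      by (rule sum.reindex_bij_witness[of _ "\<lambda>(l, s). (s, l)" "\<lambda>(s, l). (l, s)"]) auto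
    finally show ?thesis
      by (simp add: sum.Sigma)
  qed
  have telescope: "(\<Sum>s<n. ?V s - ?V (Suc s)) = v - ?V n" for n
    using sum_lessThan_telescope'[of ?V n] by (simp del: matrix_power.simps(2))
  \<comment> \<open>Division of f(1) - f(z) by 1 - z: the quotient applied to \<open>v\<close> is
    \<open>w\<close>, and the term f(A) v vanishes by \<open>fv\<close>.\<close>
  have "w - A *v w = (\<Sum>l\<le>r. a l *s (\<Sum>s<r - l. ?V s - ?V (Suc s)))"
    by (simp add: w_swap matrix_vector_mul_sum vec.scale_sum_right AV vec.scale_right_diff_distrib
        sum_subtractf vector_scalar_commute del: matrix_power.simps)
  also have "\<dots> = (\<Sum>l\<le>r. a l *s v) - (\<Sum>l\<le>r. a l *s ?V (r - l))"
    by (subst telescope) (simp only: vec.scale_right_diff_distrib sum_subtractf)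
  finally have w: "w - A *v w = poly f 1 *s v"
    by (simp add: fv f1 vec.scale_sum_left)
  \<comment> \<open>The Neumann series on (1 - A) w, which is f(1) v, telescopes.\<close>
  have partial: "poly f 1 *s (\<Sum>s<n. ?V s) = w - matrix_power A n *v w" for n
  proof (induction n)
    case (Suc n)
    have "poly f 1 *s (\<Sum>s<Suc n. ?V s)
        = w - matrix_power A n *v w + matrix_power A n *v (poly f 1 *s v)"
      by (simp add: vec.scale_right_distrib Suc vector_scalar_commute)
    also have "\<dots> = w - matrix_power A (Suc n) *v w"
      unfolding w[symmetric]
      by (simp add: matrix_vector_mult_diff_distrib matrix_vector_mul_assoc matrix_power_commute)
    finally show ?case .
  qed simp
  \<comment> \<open>Through this identity \<open>W\<close> kills the whole orbit of
    \<open>v\<close>, hence \<open>w\<close>, so the remainder A^n w tends to 0.\<close>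
  have WA: "W ** A = W"
  proof (rule LIMSEQ_unique)
    show "(\<lambda>m. matrix_power A (Suc m)) \<longlonglongrightarrow> W ** A"
      unfolding matrix_power.simps matrix_power_commute by (intro tendsto_matrix_mul_left lim)
    show "(\<lambda>m. matrix_power A (Suc m)) \<longlonglongrightarrow> W"
      by (rule LIMSEQ_Suc[OF lim])
  qed
  have "W *v ?V s = 0" for s
  proof (induction s)
    case (Suc s)
    then show ?case
      by (simp add: matrix_vector_mul_assoc matrix_mul_assoc WA)
  qed (simp add: v)
  then have "W *v w = 0"
    by (simp add: w_def matrix_vector_mul_sum vector_scalar_commute)
  then have lim_partial: "(\<lambda>n. w - matrix_power A n *v w) \<longlonglongrightarrow> w"
    using tendsto_diff[OF tendsto_const tendsto_matrix_vector_mul_left[OF lim, of w], of w] by simp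
  have "(\<Sum>s<n. ?V s) = (1 / poly f 1) *s (w - matrix_power A n *v w)" for n
    using minimal_polynomial_simple_root_1[OF lim p p_f] by (simp flip: partial)
  moreover have "(\<lambda>n. (1 / poly f 1) *s (w - matrix_power A n *v w)) \<longlonglongrightarrow> (1 / poly f 1) *s w"
    unfolding vector_scalar_mult_def by (intro tendsto_intros lim_partial)
  ultimately show ?thesis
    by (simp add: sums_def w_def)
qed

section \<open>First visits\<close>

definition site :: "'k \<Rightarrow> complex^('k::finite \<times> 'n::finite \<times> 'n) \<Rightarrow> complex^'n^'n" where
  "site i v = (\<chi> a b. v $ (i, a, b))"

definition place :: "'k \<Rightarrow> complex^'n^'n \<Rightarrow> complex^('k::finite \<times> 'n::finite \<times> 'n)" where
  "place j X = (\<chi> u. case u of (l, a, b) \<Rightarrow> if l = j then X $ a $ b else 0)"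

definition total_trace :: "complex^('k::finite \<times> 'n::finite \<times> 'n) \<Rightarrow> complex" where
  "total_trace v = (\<Sum>l\<in>UNIV. trace (site l v))"

text \<open>Deletion comes after the step, so time 0 is unconstrained: the r-th iterate carries the
  trajectories that avoid \<open>i\<close> at times 1 to r, and a start at \<open>i\<close> itself
  leads to first returns.\<close>

definition taboo_step ::
    "('k::finite \<Rightarrow> 'k \<Rightarrow> complex^'n::finite^'n) \<Rightarrow> 'k \<Rightarrow>
      complex^('k \<times> 'n \<times> 'n) \<Rightarrow> complex^('k \<times> 'n \<times> 'n)" where
  "taboo_step B i v = oqw_matrix B *v v - place i (site i (oqw_matrix B *v v))"

lemma site_nth: "site i v $ a $ b = v $ (i, a, b)"
  by (simp add: site_def)

lemma vec_eq_siteI: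
  assumes "\<And>i. site i v = site i w"
  shows "v = w"
proof -
  have "v $ (i, a, b) = w $ (i, a, b)" for i a b
    using assms[of i] by (metis site_nth)
  then show ?thesis
    by (simp add: vec_eq_iff)
qed

lemma site_simps [simp]:
  "site i 0 = 0" "site i (v + w) = site i v + site i w" "site i (v - w) = site i v - site i w"
  "site i (t *\<^sub>R v) = t *\<^sub>R site i v" "site i (c *s v) = cscale c (site i v)"
  by (simp_all add: vec_eq_iff site_nth)

lemma site_place: "site i (place j X) = (if i = j then X else 0)"
  by (simp add: vec_eq_iff site_nth place_def)

lemma site_place_same [simp]: "site i (place i X) = X"
  by (simp add: site_place)

lemma site_sum: "site i (\<Sum>s\<in>S. v s) = (\<Sum>s\<in>S. site i (v s))"
  by (induction S rule: infinite_finite_induct) simp_all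

lemma place_simps [simp]:
  "place j 0 = 0" "place j (X + Y) = place j X + place j Y" "place j (X - Y) = place j X - place j Y"
  "place j (t *\<^sub>R X) = t *\<^sub>R place j X" "place j (cscale c X) = c *s place j X"
  by (simp_all add: vec_eq_iff place_def)

lemma sum_place_site: "(\<Sum>j\<in>UNIV. place j (site j v)) = v"
  by (rule vec_eq_siteI) (simp add: site_sum site_place)

lemma trace_simps [simp]:
  "trace (t *\<^sub>R X) = t *\<^sub>R trace X" "trace (0 :: 'a::real_normed_algebra_1^'n^'n) = 0"
  for X :: "'a::real_normed_algebra_1^'n^'n"
  by (simp_all add: trace_def scaleR_sum_right)

lemma trace_cscale [simp]: "trace (cscale c X) = c * trace X"
  by (simp add: trace_def sum_distrib_left)

lemma total_trace_simps [simp]: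
  "total_trace 0 = 0" "total_trace (v + w) = total_trace v + total_trace w"
  "total_trace (v - w) = total_trace v - total_trace w"
  "total_trace (t *\<^sub>R v) = t *\<^sub>R total_trace v"
  by (simp_all add: total_trace_def trace_add trace_sub sum.distrib sum_subtractf scaleR_sum_right)

lemma total_trace_place [simp]: "total_trace (place j X) = trace X"
  by (simp add: total_trace_def site_place if_distrib[of trace] cong: if_cong)

lemma cadjoint_mul: "cadjoint (A ** B) = cadjoint B ** cadjoint A"
  by (simp add: vec_eq_iff cadjoint_def matrix_matrix_mult_def mult.commute)

lemma cadjoint_mat_1 [simp]: "cadjoint (mat 1) = mat 1"
  by (auto simp: vec_eq_iff cadjoint_def mat_def)

lemma conj_map_mul: "conj_map (A ** B) X = conj_map A (conj_map B X)"
  by (simp add: conj_map_def cadjoint_mul matrix_mul_assoc)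

lemma conj_map_0 [simp]: "conj_map C 0 = 0"
  by (simp add: conj_map_def)

lemma conj_map_mat_1 [simp]: "conj_map (mat 1) X = X"
  by (simp add: conj_map_def)

lemma conj_map_add [simp]: "conj_map C (X + Y) = conj_map C X + conj_map C Y"
  by (simp add: conj_map_def matrix_add_ldistrib matrix_matrix_mul_add_left)

lemma conj_map_nth:
  "conj_map C X $ a $ b = (\<Sum>c\<in>UNIV. \<Sum>d\<in>UNIV. C $ a $ c * cnj (C $ b $ d) * X $ c $ d)"
proof -
  have "conj_map C X $ a $ b = (\<Sum>d\<in>UNIV. \<Sum>c\<in>UNIV. C $ a $ c * X $ c $ d * cnj (C $ b $ d))"
    by (simp add: conj_map_def matrix_matrix_mult_def cadjoint_def sum_distrib_right)
  also have "\<dots> = (\<Sum>c\<in>UNIV. \<Sum>d\<in>UNIV. C $ a $ c * X $ c $ d * cnj (C $ b $ d))"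
    by (rule sum.swap)
  finally show ?thesis
    by (simp add: mult_ac)
qed

lemma sum_UNIV_triple:
  fixes g :: "'a::finite \<times> 'b::finite \<times> 'c::finite \<Rightarrow> 'd::comm_monoid_add"
  shows "(\<Sum>u\<in>UNIV. g u) = (\<Sum>i\<in>UNIV. \<Sum>a\<in>UNIV. \<Sum>b\<in>UNIV. g (i, a, b))"
  by (simp flip: UNIV_Times_UNIV add: sum.cartesian_product' del: UNIV_Times_UNIV)

lemma site_oqw_matrix:
  "site i (oqw_matrix B *v v) = (\<Sum>j\<in>UNIV. conj_map (B i j) (site j v))"
proof -
  have "(oqw_matrix B *v v) $ (i, a, b) = (\<Sum>j\<in>UNIV. conj_map (B i j) (site j v) $ a $ b)" for a b
    by (simp add: matrix_vector_mult_def oqw_matrix_def conj_map_nth site_nth sum_UNIV_triple)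
  then show ?thesis
    by (simp add: vec_eq_iff site_nth)
qed

lemma trace_conj_map: "trace (conj_map C X) = trace ((cadjoint C ** C) ** X)"
  unfolding conj_map_def by (subst trace_mul_sym) (simp add: matrix_mul_assoc)

lemma trace_sum: "trace (\<Sum>s\<in>S. X s) = (\<Sum>s\<in>S. trace (X s))"
  for X :: "'i \<Rightarrow> complex^'n^'n"
  by (induction S rule: infinite_finite_induct) (simp_all add: trace_add)

text \<open>Cyclicity of the trace moves \<open>cadjoint (B i j)\<close> next to
  \<open>B i j\<close>, and the normalisation sums these products over \<open>i\<close> to the
  identity.\<close>

lemma total_trace_oqw_matrix:
  assumes "is_oqw B"
  shows "total_trace (oqw_matrix B *v v) = total_trace v"
proof -
  have "total_trace (oqw_matrix B *v v)
      = (\<Sum>i\<in>UNIV. \<Sum>j\<in>UNIV. trace ((cadjoint (B i j) ** B i j) ** site j v))"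
    by (simp add: total_trace_def site_oqw_matrix trace_sum trace_conj_map)
  also have "\<dots> = (\<Sum>j\<in>UNIV. \<Sum>i\<in>UNIV. trace ((cadjoint (B i j) ** B i j) ** site j v))"
    by (rule sum.swap)
  also have "\<dots> = (\<Sum>j\<in>UNIV. trace ((\<Sum>i\<in>UNIV. cadjoint (B i j) ** B i j) ** site j v))"
    by (simp add: matrix_mul_sum_left trace_sum)
  finally show ?thesis
    using assms by (simp add: is_oqw_def total_trace_def)
qed

lemma total_trace_matrix_power:
  assumes "is_oqw B"
  shows "total_trace (matrix_power (oqw_matrix B) s *v v) = total_trace v"
  by (induction s) (simp_all add: total_trace_oqw_matrix[OF assms] flip: matrix_vector_mul_assoc)

text \<open>Turns block powers into orbits of a placed matrix, to which limits and matrix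
  polynomials apply.\<close>

lemma block_power_oqw_block:
  "block_power (oqw_block B) s i j X = site i (matrix_power (oqw_matrix B) s *v place j X)"
proof (induction s arbitrary: i)
  case (Suc s)
  then show ?case
    by (simp add: block_mult_def oqw_block_def site_oqw_matrix flip: matrix_vector_mul_assoc)
qed (simp add: block_id_def site_place)

section \<open>Steps that avoid a fixed site\<close>

lemma site_taboo_step:
  "site l (taboo_step B i v) = (if l = i then 0 else site l (oqw_matrix B *v v))"
  by (simp add: taboo_step_def site_place)

lemma matrix_vector_mul_scaleR:
  fixes A :: "'a::real_normed_field^'n^'m"
  shows "A *v (t *\<^sub>R v) = t *\<^sub>R (A *v v)"
  by (simp add: vec_eq_iff matrix_vector_mult_def scaleR_sum_right)

lemma taboo_step_simps [simp]:
  "taboo_step B i 0 = 0"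
  "taboo_step B i (v + w) = taboo_step B i v + taboo_step B i w"
  "taboo_step B i (v - w) = taboo_step B i v - taboo_step B i w"
  "taboo_step B i (t *\<^sub>R v) = t *\<^sub>R taboo_step B i v"
  "taboo_step B i (c *s v) = c *s taboo_step B i v"
  by (rule vec_eq_siteI, simp add: site_taboo_step matrix_vector_right_distrib
      matrix_vector_mult_diff_distrib matrix_vector_mul_scaleR vector_scalar_commute)+

lemma taboo_power_simps [simp]:
  "(taboo_step B i ^^ r) 0 = 0"
  "(taboo_step B i ^^ r) (v + w) = (taboo_step B i ^^ r) v + (taboo_step B i ^^ r) w"
  "(taboo_step B i ^^ r) (v - w) = (taboo_step B i ^^ r) v - (taboo_step B i ^^ r) w"
  "(taboo_step B i ^^ r) (t *\<^sub>R v) = t *\<^sub>R (taboo_step B i ^^ r) v"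
  "(taboo_step B i ^^ r) (c *s v) = c *s (taboo_step B i ^^ r) v"
  by (induction r) simp_all

lemma taboo_power_sum:
  "(taboo_step B i ^^ r) (\<Sum>s\<in>S. v s) = (\<Sum>s\<in>S. (taboo_step B i ^^ r) (v s))"
  by (induction S rule: infinite_finite_induct) simp_all

section \<open>Paths of first visits\<close>

lemma finite_first_visits [simp]: "finite (first_visits i (j::'k::finite) r)"
  by (rule finite_subset[OF _ finite_lists_length_eq[of "UNIV :: 'k set" "Suc r"]])
    (auto simp: first_visits_def)

lemma first_visits_1: "first_visits i j (Suc 0) = {[j, i]}"
  by (auto simp: first_visits_def length_Suc_conv)

text \<open>Decomposition by the site \<open>l\<close> at time 1. With at least two steps, time 1
  precedes the visit to \<open>i\<close>, whence \<open>l\<close> differs from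
  \<open>i\<close>.\<close>

lemma first_visits_Suc:
  "first_visits i j (Suc (Suc r)) = (\<Union>l\<in>UNIV - {i}. (#) j ` first_visits i l (Suc r))"
proof (intro set_eqI iffI)
  fix w assume w: "w \<in> first_visits i j (Suc (Suc r))"
  then obtain u where u: "w = j # u"
    by (cases w) (auto simp: first_visits_def)
  have "u \<in> first_visits i (u ! 0) (Suc r)"
    using w unfolding first_visits_def u by (auto simp: nth_Cons' split: if_splits)
  moreover have "u ! 0 \<noteq> i"
    using w unfolding first_visits_def u by (auto dest!: spec[of _ 1])
  ultimately show "w \<in> (\<Union>l\<in>UNIV - {i}. (#) j ` first_visits i l (Suc r))"
    using u by blast
next
  fix w assume "w \<in> (\<Union>l\<in>UNIV - {i}. (#) j ` first_visits i l (Suc r))"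
  then obtain l u where "l \<noteq> i" "w = j # u" "u \<in> first_visits i l (Suc r)"
    by blast
  \<comment> \<open>An inner position \<open>m\<close> of \<open>w\<close> is position
    \<open>m - 1\<close> of \<open>u\<close>: at 0 the entry is \<open>l\<close>, elsewhere the
    avoidance condition of \<open>u\<close> applies.\<close>
  then show "w \<in> first_visits i j (Suc (Suc r))"
    by (auto simp: first_visits_def nth_Cons')
      (metis One_nat_def Suc_less_eq Suc_pred neq0_conv)
qed

text \<open>\<open>path_product\<close> unfolds only at two leading sites; membership makes
  \<open>u\<close> nonempty with head \<open>l\<close>.\<close>

lemma path_product_first_visits:
  assumes "u \<in> first_visits i l (Suc r)"
  shows "path_product B (j # u) = path_product B u ** B l j"
  using assms by (cases u) (auto simp: first_visits_def)

text \<open>Induction by splitting off the first step. It replaces \<open>X\<close> at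
  \<open>j\<close> by \<open>conj_map (B l j) X\<close> at every \<open>l\<close> other than
  \<open>i\<close>, and these together form \<open>taboo_step B i (place j X)\<close>; hence
  \<open>j\<close> and \<open>X\<close> must be arbitrary.\<close>

lemma sum_first_visits:
  "(\<Sum>w\<in>first_visits i j (Suc r). conj_map (path_product B w) X)
    = site i (oqw_matrix B *v (taboo_step B i ^^ r) (place j X))"
proof (induction r arbitrary: j X)
  case 0
  then show ?case
    by (simp add: first_visits_1 site_oqw_matrix site_place if_distrib[of "conj_map _"] cong: if_cong)
next
  case (Suc r)
  \<comment> \<open>The pieces for different \<open>l\<close> are disjoint, as \<open>l\<close> is
    the second entry of the list.\<close>
  have "(\<Sum>w\<in>first_visits i j (Suc (Suc r)). conj_map (path_product B w) X)
      = (\<Sum>l\<in>UNIV - {i}. \<Sum>w\<in>(#) j ` first_visits i l (Suc r). conj_map (path_product B w) X)"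
    unfolding first_visits_Suc
    by (rule sum.UNION_disjoint) (simp, simp, auto simp: first_visits_def)
  also have "\<dots> = (\<Sum>l\<in>UNIV - {i}. \<Sum>u\<in>first_visits i l (Suc r).
      conj_map (path_product B u) (conj_map (B l j) X))"
    by (simp add: sum.reindex path_product_first_visits conj_map_mul cong: sum.cong_simp)
  also have "\<dots> = (\<Sum>l\<in>UNIV - {i}.
      site i (oqw_matrix B *v (taboo_step B i ^^ r) (place l (conj_map (B l j) X))))"
    by (simp add: Suc.IH)
  also have "\<dots> = site i (oqw_matrix B *v (taboo_step B i ^^ r)
      (\<Sum>l\<in>UNIV - {i}. place l (conj_map (B l j) X)))"
    by (simp add: taboo_power_sum matrix_vector_mul_sum site_sum)
  also have "(\<Sum>l\<in>UNIV - {i}. place l (conj_map (B l j) X)) = taboo_step B i (place j X)"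
    by (rule vec_eq_siteI)
      (simp add: site_taboo_step site_oqw_matrix site_sum site_place
        if_distrib[of "conj_map _"] cong: if_cong)
  finally show ?case
    by (simp add: funpow_swap1)
qed

section \<open>Positivity and decay\<close>

definition outer :: "complex^'n \<Rightarrow> complex^'n \<Rightarrow> complex^'n^'n" where
  "outer u w = (\<chi> a b. u $ a * cnj (w $ b))"

text \<open>Positive semidefinite matrices, presented as the finite sums of rank-one matrices \<open>u u*\<close>.\<close>

inductive psd :: "complex^'n::finite^'n \<Rightarrow> bool" where
  zero: "psd 0"
| add_outer: "psd X \<Longrightarrow> psd (X + outer u u)"

definition positive :: "complex^('k::finite \<times> 'n::finite \<times> 'n) \<Rightarrow> bool" where
  "positive v \<longleftrightarrow> (\<forall>l. psd (site l v))"

lemma psd_outer: "psd (outer u u)"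
  using psd.add_outer[OF psd.zero] by simp

lemma psd_add: "psd Y \<Longrightarrow> psd X \<Longrightarrow> psd (X + Y)"
  by (induction rule: psd.induct) (auto simp: add.assoc[symmetric] intro: psd.add_outer)

lemma psd_sum: "(\<And>s. s \<in> S \<Longrightarrow> psd (X s)) \<Longrightarrow> psd (\<Sum>s\<in>S. X s)"
  by (induction S rule: infinite_finite_induct) (auto intro: psd.zero psd_add)

lemma conj_map_outer: "conj_map C (outer u w) = outer (C *v u) (C *v w)"
proof -
  have "conj_map C (outer u w) $ a $ b = outer (C *v u) (C *v w) $ a $ b" for a b
    unfolding conj_map_nth
    by (simp add: outer_def matrix_vector_mult_def sum_product mult_ac)
  then show ?thesis
    by (simp add: vec_eq_iff)
qed

lemma psd_conj_map: "psd X \<Longrightarrow> psd (conj_map C X)"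
  by (induction rule: psd.induct) (auto simp: conj_map_outer intro: psd.intros)

text \<open>The product of two moduli is at most the mean of their squares, and each square is at
  most the squared norm of \<open>u\<close>, which is the trace.\<close>

lemma norm_outer_nth_le: "cmod (outer u u $ a $ b) \<le> Re (trace (outer u u))"
proof -
  have "(cmod (u $ c))\<^sup>2 \<le> (\<Sum>c\<in>UNIV. (cmod (u $ c))\<^sup>2)" for c
    by (rule member_le_sum) auto
  from this[of a] this[of b] have "cmod (u $ a) * cmod (u $ b) \<le> (\<Sum>c\<in>UNIV. (cmod (u $ c))\<^sup>2)"
    using sum_squares_bound[of "cmod (u $ a)" "cmod (u $ b)"] by linarith
  moreover have "Re (trace (outer u u)) = (\<Sum>c\<in>UNIV. (cmod (u $ c))\<^sup>2)"
    unfolding cmod_power2 by (simp add: trace_def outer_def power2_eq_square)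
  ultimately show ?thesis
    by (simp add: outer_def norm_mult)
qed

text \<open>The modulus is subadditive and the trace additive, so the rank-one bound passes along
  the sum.\<close>

lemma norm_psd_nth_le: "psd X \<Longrightarrow> cmod (X $ a $ b) \<le> Re (trace X)"
proof (induction rule: psd.induct)
  case (add_outer X u)
  have "cmod ((X + outer u u) $ a $ b) \<le> cmod (X $ a $ b) + cmod (outer u u $ a $ b)"
    by (simp add: norm_triangle_ineq)
  then show ?case
    using add_outer norm_outer_nth_le[of u a b] by (simp add: trace_add)
qed simp

lemma psd_trace_nonneg: "psd X \<Longrightarrow> 0 \<le> Re (trace X)"
  using norm_psd_nth_le order_trans norm_ge_zero by blast

lemma positive_0: "positive 0"
  by (simp add: positive_def psd.zero)

lemma positive_add: "positive v \<Longrightarrow> positive w \<Longrightarrow> positive (v + w)"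
  by (simp add: positive_def psd_add)

lemma positive_place: "psd X \<Longrightarrow> positive (place j X)"
  by (simp add: positive_def site_place psd.zero)

lemma positive_oqw_matrix: "positive v \<Longrightarrow> positive (oqw_matrix B *v v)"
  by (simp add: positive_def site_oqw_matrix psd_sum psd_conj_map)

lemma positive_taboo_step: "positive v \<Longrightarrow> positive (taboo_step B i v)"
  using positive_oqw_matrix[of v B] by (simp add: positive_def site_taboo_step psd.zero)

lemma positive_taboo_power: "positive v \<Longrightarrow> positive ((taboo_step B i ^^ r) v)"
  by (induction r) (simp_all add: positive_taboo_step)

lemma norm_positive_nth_le:
  assumes "positive v"
  shows "cmod (v $ u) \<le> Re (total_trace v)"
proof -
  obtain l a b where u: "u = (l, a, b)"
    by (metis prod.collapse)
  have "cmod (v $ u) \<le> Re (trace (site l v))"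
    using assms norm_psd_nth_le[of "site l v" a b] by (simp add: positive_def site_nth u)
  also have "\<dots> \<le> (\<Sum>l\<in>UNIV. Re (trace (site l v)))"
    by (rule member_le_sum) (use assms psd_trace_nonneg in \<open>auto simp: positive_def\<close>)
  finally show ?thesis
    by (simp add: total_trace_def)
qed

lemma total_trace_nonneg: "positive v \<Longrightarrow> 0 \<le> Re (total_trace v)"
  using norm_positive_nth_le order_trans norm_ge_zero by blast

text \<open>On the cone the trace controls the norm, so decay of traces is enough for
  summability.\<close>

lemma norm_positive_le:
  fixes v :: "complex^('k::finite \<times> 'n::finite \<times> 'n)"
  assumes "positive v"
  shows "norm v \<le> real CARD('k \<times> 'n \<times> 'n) * Re (total_trace v)"
proof -
  have "norm v \<le> (\<Sum>u\<in>UNIV. cmod (v $ u))"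
    unfolding norm_vec_def by (rule L2_set_le_sum) simp
  also have "\<dots> \<le> (\<Sum>u\<in>(UNIV :: ('k \<times> 'n \<times> 'n) set). Re (total_trace v))"
    by (intro sum_mono norm_positive_nth_le assms)
  finally show ?thesis
    by simp
qed

text \<open>The full step preserves the trace, so the loss is exactly what arrives at
  \<open>i\<close>.\<close>

lemma total_trace_taboo_step:
  assumes "is_oqw B"
  shows "total_trace (taboo_step B i v) = total_trace v - trace (site i (oqw_matrix B *v v))"
  by (simp add: taboo_step_def total_trace_oqw_matrix[OF assms])

lemma total_trace_taboo_step_le:
  assumes "is_oqw B" "positive v"
  shows "Re (total_trace (taboo_step B i v)) \<le> Re (total_trace v)"
  using positive_oqw_matrix[OF assms(2), of B] psd_trace_nonneg
  by (auto simp: total_trace_taboo_step[OF assms(1)] positive_def)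

text \<open>The trajectories avoiding \<open>i\<close> at all times up to \<open>m\<close> are among all trajectories.\<close>

lemma taboo_power_dominated:
  assumes "positive v"
  shows "positive (matrix_power (oqw_matrix B) m *v v - (taboo_step B i ^^ m) v)"
proof (induction m)
  case (Suc m)
  let ?M = "oqw_matrix B" and ?s = "(taboo_step B i ^^ m) v"
  \<comment> \<open>The new excess is the image of the old one plus the component just deleted at
    \<open>i\<close>.\<close>
  have "matrix_power ?M (Suc m) *v v - (taboo_step B i ^^ Suc m) v
      = ?M *v (matrix_power ?M m *v v - ?s) + place i (site i (?M *v ?s))"
    by (simp add: taboo_step_def matrix_vector_mult_diff_distrib flip: matrix_vector_mul_assoc)
  moreover have "psd (site i (?M *v ?s))"
    using positive_oqw_matrix[OF positive_taboo_power[OF assms]] by (simp add: positive_def)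
  ultimately show ?case
    by (simp add: positive_add positive_place positive_oqw_matrix Suc)
qed (simp add: positive_0)

section \<open>Powers of the walk and their ergodic limit\<close>

lemma matrix_vector_mul_axis: "(A *v axis k 1) $ u = A $ u $ k"
  for A :: "'a::semiring_1^'n^'m"
  by (simp add: matrix_vector_mult_def axis_def if_distrib[of "\<lambda>x. _ * x"] cong: if_cong)

lemma block_matrix_block_power:
  "block_matrix (block_power (oqw_block B) s) = matrix_power (oqw_matrix B) s"
proof -
  \<comment> \<open>A placed matrix unit is a standard basis vector, so the two matrices have the
    same columns.\<close>
  have "place j (\<chi> a' b'. if a' = c \<and> b' = d then 1 else 0) = axis (j, c, d) 1" for j :: 'a and c d :: 'b
    by (auto simp: vec_eq_iff place_def axis_def)
  then have "block_matrix (block_power (oqw_block B) s) $ u $ v = matrix_power (oqw_matrix B) s $ u $ v" for u v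
    by (cases u; cases v)
      (simp add: block_matrix_def block_power_oqw_block site_nth matrix_vector_mul_axis)
  then show ?thesis
    by (simp add: vec_eq_iff)
qed

lemma ergodic_tendsto:
  fixes B :: "'k::finite \<Rightarrow> 'k \<Rightarrow> complex^'n::finite^'n"
  assumes "ergodic_oqw B"
  shows "matrix_power (oqw_matrix B) \<longlonglongrightarrow> block_matrix (block_Omega :: ('k, 'n) block_op)"
  using assms unfolding ergodic_oqw_def block_matrix_block_power
  by (intro vec_tendstoI) auto

text \<open>The limit sees only the total trace and spreads it evenly: it kills traceless vectors
  and leaves the share 1/k of the trace at each site.\<close>

lemma site_Omega:
  fixes v :: "complex^('k::finite \<times> 'n::finite \<times> 'n)"
  shows "site i (block_matrix (block_Omega :: ('k, 'n) block_op) *v v)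
    = cscale (total_trace v / of_nat (CARD('k) * CARD('n))) (mat 1)"
proof -
  have trace_unit: "trace (\<chi> a' b'. if a' = c \<and> b' = d then 1 else (0 :: complex)) = (if c = d then 1 else 0)"
    for c d :: 'n
    by (auto simp: trace_def intro: sum.neutral)
  then have "block_matrix (block_Omega :: ('k, 'n) block_op) $ (i, a, b) $ (j, c, d)
      = (if c = d then mat 1 $ a $ b / of_nat (CARD('k) * CARD('n)) else 0)" for a b c d :: 'n and j
    by (simp add: block_matrix_def block_Omega_def)
  then have "(block_matrix (block_Omega :: ('k, 'n) block_op) *v v) $ (i, a, b)
      = (\<Sum>j\<in>UNIV. \<Sum>c\<in>UNIV. mat 1 $ a $ b / of_nat (CARD('k) * CARD('n)) * v $ (j, c, c))" for a b
    by (simp add: matrix_vector_mult_def sum_UNIV_triple if_distrib[of "\<lambda>x. x * _"] cong: if_cong)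
  moreover have "(\<Sum>j\<in>UNIV. \<Sum>c\<in>UNIV. mat 1 $ a $ b / of_nat (CARD('k) * CARD('n)) * v $ (j, c, c))
      = total_trace v / of_nat (CARD('k) * CARD('n)) * mat 1 $ a $ b" for a b :: 'n
    by (simp add: total_trace_def trace_def site_nth sum_distrib_left sum_divide_distrib mult_ac)
  ultimately show ?thesis
    by (simp add: vec_eq_iff site_nth)
qed

text \<open>For large \<open>m\<close> the full walk has at least the share \<open>\<delta>\<close>
  of the trace at \<open>i\<close>. The taboo walk has nothing there and is dominated by the full
  walk elsewhere, so it loses at least that share.\<close>

lemma taboo_power_contraction:
  fixes B :: "'k::finite \<Rightarrow> 'k \<Rightarrow> complex^'n::finite^'n"
  assumes oqw: "is_oqw B" and erg: "ergodic_oqw B"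
  obtains m \<theta> where "0 < m" "0 < \<theta>" "\<theta> < 1"
    "\<And>v. positive v \<Longrightarrow> Re (total_trace ((taboo_step B i ^^ m) v)) \<le> \<theta> * Re (total_trace v)"
proof -
  let ?M = "\<lambda>m. matrix_power (oqw_matrix B) m"
  define W where "W = block_matrix (block_Omega :: ('k, 'n) block_op)"
  \<comment> \<open>Half of the limiting share 1/k; the other half absorbs the distance from the
    limit.\<close>
  define \<delta> where "\<delta> = 1 / (2 * real CARD('k))"
  have "1 \<le> real CARD('k)"
    by (simp add: Suc_leI)
  then have "1 < 2 * real CARD('k)"
    by linarith
  then have \<delta>: "0 < \<delta>" "\<delta> < 1"
    by (simp_all add: \<delta>_def divide_less_eq)
  \<comment> \<open>Only the rows (i, a, a) enter the trace at \<open>i\<close>. Entries of a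
    positive \<open>v\<close> are bounded by its total trace, so \<open>e m\<close> bounds the error
    relative to that trace.\<close>
  define e where "e m = (\<Sum>a\<in>UNIV. \<Sum>u\<in>UNIV. cmod ((?M m - W) $ (i, a, a) $ u))" for m
  have "e \<longlonglongrightarrow> (\<Sum>a\<in>(UNIV :: 'n set). \<Sum>u\<in>(UNIV :: ('k \<times> 'n \<times> 'n) set). cmod ((W - W) $ (i, a, a) $ u))"
    unfolding e_def using ergodic_tendsto[OF erg, folded W_def]
    by (intro tendsto_sum tendsto_norm tendsto_vec_nth tendsto_diff tendsto_const)
  then have "e \<longlonglongrightarrow> 0"
    by simp
  then have "\<forall>\<^sub>F m in sequentially. e m < \<delta>"
    using \<delta>(1) by (rule order_tendstoD)
  then obtain m where m: "e m < \<delta>" "0 < m"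
    unfolding eventually_sequentially by (metis le_add2 add_gr_0 zero_less_one add.commute le_add1)
  have "Re (total_trace ((taboo_step B i ^^ m) v)) \<le> (1 - \<delta>) * Re (total_trace v)"
    if v: "positive v" for v
  proof -
    let ?t = "Re (total_trace v)"
    have "cmod (trace (site i ((?M m - W) *v v))) \<le> (\<Sum>a\<in>UNIV. cmod (\<Sum>u\<in>UNIV. (?M m - W) $ (i, a, a) $ u * v $ u))"
      by (simp add: trace_def site_nth matrix_vector_mult_def norm_sum del: vector_minus_component)
    also have "\<dots> \<le> (\<Sum>a\<in>UNIV. \<Sum>u\<in>UNIV. cmod ((?M m - W) $ (i, a, a) $ u) * ?t)"
      by (intro sum_mono sum_norm_le)
        (auto simp: norm_mult intro!: mult_left_mono norm_positive_nth_le[OF v] simp del: vector_minus_component)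
    also have "\<dots> = e m * ?t"
      by (simp add: e_def sum_distrib_right)
    also have "\<dots> \<le> \<delta> * ?t"
      by (intro mult_right_mono total_trace_nonneg v) (use m in simp)
    finally have "\<bar>Re (trace (site i ((?M m - W) *v v)))\<bar> \<le> \<delta> * ?t"
      using abs_Re_le_cmod order_trans by blast
    moreover have "trace (site i (W *v v)) = total_trace v / of_nat CARD('k)"
      by (simp add: W_def site_Omega trace_I)
    then have "Re (trace (site i (W *v v))) = 2 * \<delta> * ?t"
      by (simp add: \<delta>_def)
    ultimately have hit: "\<delta> * ?t \<le> Re (trace (site i (?M m *v v)))"
      by (simp add: matrix_vector_mult_diff_rdistrib trace_sub abs_le_iff)
    \<comment> \<open>With at least one taboo step taken, the last one has emptied site
      \<open>i\<close>.\<close>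
    obtain m' where m': "m = Suc m'"
      using m(2) gr0_implies_Suc by blast
    have "Re (total_trace ((taboo_step B i ^^ m) v))
        = (\<Sum>l\<in>UNIV. Re (trace (site l ((taboo_step B i ^^ m) v))))"
      by (simp add: total_trace_def)
    also have "\<dots> \<le> (\<Sum>l\<in>UNIV. Re (trace (site l (?M m *v v))) - (if l = i then Re (trace (site i (?M m *v v))) else 0))"
    proof (rule sum_mono)
      fix l
      have "psd (site l (?M m *v v - (taboo_step B i ^^ m) v))"
        using taboo_power_dominated[OF v] by (simp add: positive_def)
      then have "0 \<le> Re (trace (site l (?M m *v v - (taboo_step B i ^^ m) v)))"
        by (rule psd_trace_nonneg)
      moreover have "site i ((taboo_step B i ^^ m) v) = 0"
        by (simp add: m' site_taboo_step)
      ultimately show "Re (trace (site l ((taboo_step B i ^^ m) v)))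
          \<le> Re (trace (site l (?M m *v v))) - (if l = i then Re (trace (site i (?M m *v v))) else 0)"
        by (auto simp: trace_sub)
    qed
    also have "\<dots> = Re (total_trace (?M m *v v)) - Re (trace (site i (?M m *v v)))"
      by (simp add: sum_subtractf total_trace_def)
    also have "\<dots> \<le> ?t - \<delta> * ?t"
      using hit by (simp add: total_trace_matrix_power[OF oqw])
    finally show ?thesis
      by (simp add: algebra_simps)
  qed
  then show thesis
    using that[of m "1 - \<delta>"] \<delta> m(2) by simp
qed

text \<open>A factor \<open>\<theta>\<close> every \<open>m\<close> steps amounts to a geometric
  bound with ratio the m-th root of \<open>\<theta>\<close>, and a geometric series stays summable
  with linear weights.\<close>

lemma summable_Suc_mult_geometric_decay:
  fixes t :: "nat \<Rightarrow> real"
  assumes nonneg: "\<And>r. 0 \<le> t r" and decr: "\<And>r. t (Suc r) \<le> t r"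
    and m: "0 < m" and \<theta>: "0 < \<theta>" "\<theta> < 1" and contr: "\<And>r. t (m + r) \<le> \<theta> * t r"
  shows "summable (\<lambda>r. real (Suc r) * t r)"
proof -
  define q where "q = root m \<theta>"
  have q: "0 < q" "q < 1" "q ^ m = \<theta>"
    using m \<theta> by (simp_all add: q_def)
  \<comment> \<open>Dividing by \<open>\<theta>\<close> pays for the first incomplete block, where
    \<open>q ^ r\<close> is still at least \<open>q ^ m = \<theta>\<close>.\<close>
  have "t r \<le> t 0 / \<theta> * q ^ r" for r
  proof (induction r rule: less_induct)
    case (less r)
    show ?case
    proof (cases "r < m")
      case True
      have "\<theta> \<le> q ^ r"
        unfolding q(3)[symmetric] by (rule power_decreasing) (use True q in auto)
      then have "t 0 * \<theta> \<le> t 0 * q ^ r"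
        using nonneg by (intro mult_left_mono)
      moreover have "t r \<le> t 0"
        by (rule lift_Suc_antimono_le[of t]) (auto simp: decr)
      ultimately show ?thesis
        using \<theta> by (simp add: field_simps)
          (metis (no_types, lifting) mult_left_mono order_trans less_imp_le)
    next
      case False
      then have r: "r = m + (r - m)"
        by simp
      have "t r \<le> \<theta> * t (r - m)"
        using contr[of "r - m"] r by simp
      also have "\<dots> \<le> \<theta> * (t 0 / \<theta> * q ^ (r - m))"
        using less[of "r - m"] m False \<theta> by (intro mult_left_mono) auto
      also have "\<dots> = t 0 / \<theta> * (q ^ m * q ^ (r - m))"
        by (simp add: q(3))
      finally show ?thesis
        using r by (simp flip: power_add)
    qed
  qed
  then have "norm (real (Suc r) * t r) \<le> t 0 / \<theta> * (real (Suc r) * q ^ r)" for r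
    using nonneg mult_left_mono[of "t r" "t 0 / \<theta> * q ^ r" "real (Suc r)"]
    by (simp add: mult_ac)
  moreover have "summable (\<lambda>r. t 0 / \<theta> * (real (Suc r) * q ^ r))"
    using geometric_deriv_sums[of q] q by (intro summable_mult) (auto simp: summable_def)
  ultimately show ?thesis
    by (rule summable_comparison_test'[where N = 0, rotated])
qed

section \<open>Summability of the hitting time series\<close>

lemma norm_vector_scalar_mult: "norm (c *s v) = norm c * norm v" for v :: "complex^'m"
  by (simp add: norm_vec_def norm_mult L2_set_right_distrib)

definition summable_hitting ::
    "('k::finite \<Rightarrow> 'k \<Rightarrow> complex^'n::finite^'n) \<Rightarrow> 'k \<Rightarrow> complex^('k \<times> 'n \<times> 'n) \<Rightarrow> bool" where
  "summable_hitting B i v \<longleftrightarrow> summable (\<lambda>r. real (Suc r) * norm ((taboo_step B i ^^ r) v))"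

lemma summable_hitting_scale:
  assumes "summable_hitting B i v"
  shows "summable_hitting B i (c *s v)"
  using summable_mult[OF assms[unfolded summable_hitting_def], of "cmod c"]
  by (simp add: summable_hitting_def norm_vector_scalar_mult mult_ac)

lemma summable_hitting_add:
  assumes "summable_hitting B i v" "summable_hitting B i w"
  shows "summable_hitting B i (v + w)"
  unfolding summable_hitting_def
proof (rule summable_comparison_test'[where N = 0])
  show "summable (\<lambda>r. real (Suc r) * norm ((taboo_step B i ^^ r) v) + real (Suc r) * norm ((taboo_step B i ^^ r) w))"
    using assms unfolding summable_hitting_def by (rule summable_add)
  show "norm (real (Suc r) * norm ((taboo_step B i ^^ r) (v + w)))
      \<le> real (Suc r) * norm ((taboo_step B i ^^ r) v) + real (Suc r) * norm ((taboo_step B i ^^ r) w)" for r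
    by (simp add: distrib_left[symmetric] norm_triangle_ineq mult_left_mono del: of_nat_Suc)
qed

lemma summable_hitting_sum:
  "(\<And>s. s \<in> S \<Longrightarrow> summable_hitting B i (v s)) \<Longrightarrow> summable_hitting B i (\<Sum>s\<in>S. v s)"
  by (induction S rule: infinite_finite_induct)
    (auto intro: summable_hitting_add simp: summable_hitting_def[of B i 0])

text \<open>The traces of the taboo iterates decrease, contract every \<open>m\<close> steps and
  dominate the norms up to a constant.\<close>

lemma summable_hitting_positive:
  fixes B :: "'k::finite \<Rightarrow> 'k \<Rightarrow> complex^'n::finite^'n"
  assumes oqw: "is_oqw B" and erg: "ergodic_oqw B" and v: "positive v"
  shows "summable_hitting B i v"
proof -
  define t where "t r = Re (total_trace ((taboo_step B i ^^ r) v))" for r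
  obtain m \<theta> where m: "0 < m" and \<theta>: "0 < \<theta>" "\<theta> < 1"
    and contr: "\<And>v. positive v \<Longrightarrow> Re (total_trace ((taboo_step B i ^^ m) v)) \<le> \<theta> * Re (total_trace v)"
    using taboo_power_contraction[OF oqw erg] by blast
  have pos: "positive ((taboo_step B i ^^ r) v)" for r
    by (rule positive_taboo_power[OF v])
  have "summable (\<lambda>r. real (Suc r) * t r)"
  proof (rule summable_Suc_mult_geometric_decay[OF _ _ m \<theta>])
    show "t (m + r) \<le> \<theta> * t r" for r
      using contr[OF pos[of r]] by (simp add: t_def funpow_add)
  qed (simp_all add: t_def total_trace_nonneg total_trace_taboo_step_le[OF oqw] pos)
  then have "summable (\<lambda>r. real CARD('k \<times> 'n \<times> 'n) * (real (Suc r) * t r))"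
    by (rule summable_mult)
  moreover have "norm (real (Suc r) * norm ((taboo_step B i ^^ r) v))
      \<le> real CARD('k \<times> 'n \<times> 'n) * (real (Suc r) * t r)" for r
    using mult_left_mono[OF norm_positive_le[OF pos[of r]], of "real (Suc r)"]
    by (simp add: t_def mult_ac del: of_nat_Suc)
  ultimately show ?thesis
    unfolding summable_hitting_def by (rule summable_comparison_test'[where N = 0])
qed

text \<open>Polarization. Differences are written as sums with scalars -1 and \<open>-\<i>\<close>,
  so that closure under sums and scaling applies directly.\<close>

lemma outer_polarization:
  "outer u w = cscale (1 / 4) (outer (u + w) (u + w) + cscale (-1) (outer (u - w) (u - w))
    + (cscale \<i> (outer (u + \<i> *s w) (u + \<i> *s w)) + cscale (-\<i>) (outer (u - \<i> *s w) (u - \<i> *s w))))"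
  by (simp add: vec_eq_iff outer_def algebra_simps)

lemma matrix_eq_sum_outer: "X = (\<Sum>d\<in>UNIV. outer (column d X) (axis d 1))"
  by (simp add: vec_eq_iff outer_def column_def axis_def if_distrib[of cnj]
      if_distrib[of "\<lambda>x. _ * x"] cong: if_cong)

text \<open>Polarization extends the positive case to all rank-one matrices; these span the
  matrices, and placed matrices span the column vectors.\<close>

lemma summable_hitting:
  assumes oqw: "is_oqw B" and erg: "ergodic_oqw B"
  shows "summable_hitting B i v"
proof -
  have diag: "summable_hitting B i (place j (outer u u))" for j u
    by (intro summable_hitting_positive[OF oqw erg] positive_place psd_outer)
  have outer: "summable_hitting B i (place j (outer u w))" for j u w
    unfolding outer_polarization[of u w] place_simps
    by (intro summable_hitting_scale summable_hitting_add diag)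
  have place_sum: "place j (\<Sum>s\<in>S. X s) = (\<Sum>s\<in>S. place j (X s))" for j S and X :: "'b \<Rightarrow> complex^'b^'b"
    by (induction S rule: infinite_finite_induct) simp_all
  have "summable_hitting B i (place j X)" for j X
    by (subst matrix_eq_sum_outer) (simp add: place_sum summable_hitting_sum outer)
  then show ?thesis
    by (subst sum_place_site[symmetric]) (simp add: summable_hitting_sum)
qed

section \<open>Mean hitting times\<close>

text \<open>\<open>r\<close> taboo steps followed by an arrival at \<open>i\<close> make a first
  visit at time r + 1, hence the weight. All column vectors are allowed, so that it can be evaluated
  along orbits of the walk.\<close>

definition hitting_operator ::
    "('k::finite \<Rightarrow> 'k \<Rightarrow> complex^'n::finite^'n) \<Rightarrow> 'k \<Rightarrow> complex^('k \<times> 'n \<times> 'n) \<Rightarrow> complex^'n^'n" where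
  "hitting_operator B i v =
    (\<Sum>r. real (Suc r) *\<^sub>R site i (oqw_matrix B *v (taboo_step B i ^^ r) v))"

lemma linear_trace: "linear (trace :: complex^'n^'n \<Rightarrow> complex)"
  by (rule linearI) (simp_all add: trace_add)

lemma linear_total_trace: "linear total_trace"
  by (rule linearI) simp_all

lemma linear_cscale: "linear (cscale c)"
  by (rule linearI) (simp_all add: vec_eq_iff algebra_simps)

lemma bounded_linear_site_oqw_matrix: "bounded_linear (\<lambda>v. site i (oqw_matrix B *v v))"
  unfolding linear_conv_bounded_linear[symmetric]
  by (rule linearI) (simp_all add: matrix_vector_right_distrib matrix_vector_mul_scaleR)

lemma mean_hitting_time_eq: "mean_hitting_time B i j X = hitting_operator B i (place j X)"
  unfolding mean_hitting_time_def hitting_operator_def sum_first_visits ..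

context
  fixes B :: "'k::finite \<Rightarrow> 'k \<Rightarrow> complex^'n::finite^'n" and i :: 'k
  assumes oqw: "is_oqw B" and erg: "ergodic_oqw B"
begin

lemma summable_taboo_power: "summable (\<lambda>r. real (Suc r) *\<^sub>R (taboo_step B i ^^ r) v)"
  by (rule summable_norm_cancel)
    (use summable_hitting[OF oqw erg, of i v] in \<open>simp add: summable_hitting_def\<close>)

text \<open>Terms of a convergent series tend to 0, and the weight \<open>Suc r\<close> is at least
  1.\<close>

lemma taboo_power_tendsto_0: "(\<lambda>r. (taboo_step B i ^^ r) v) \<longlonglongrightarrow> 0"
proof (rule tendsto_0_le[where K = 1])
  show "(\<lambda>r. real (Suc r) *\<^sub>R (taboo_step B i ^^ r) v) \<longlonglongrightarrow> 0"
    by (rule summable_LIMSEQ_zero[OF summable_taboo_power])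
  show "\<forall>\<^sub>F r in sequentially.
      norm ((taboo_step B i ^^ r) v) \<le> norm (real (Suc r) *\<^sub>R (taboo_step B i ^^ r) v) * 1"
    by (auto intro!: always_eventually simp: mult_le_cancel_right1)
qed

text \<open>The bare infinite sum in the definition carries no convergence; it comes from the
  summable taboo powers through a bounded linear map.\<close>

lemma hitting_operator_sums:
  "(\<lambda>r. real (Suc r) *\<^sub>R site i (oqw_matrix B *v (taboo_step B i ^^ r) v))
    sums hitting_operator B i v"
proof -
  have "summable (\<lambda>r. site i (oqw_matrix B *v (real (Suc r) *\<^sub>R (taboo_step B i ^^ r) v)))"
    by (rule bounded_linear.summable[OF bounded_linear_site_oqw_matrix summable_taboo_power])
  then show ?thesis
    unfolding hitting_operator_def
    by (simp add: matrix_vector_mul_scaleR summable_sums del: of_nat_Suc)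
qed

lemma linear_hitting_operator: "linear (hitting_operator B i)"
proof (rule linearI)
  show "hitting_operator B i (v + w) = hitting_operator B i v + hitting_operator B i w" for v w
    using sums_add[OF hitting_operator_sums[of v] hitting_operator_sums[of w]]
    by (intro sums_unique2[OF hitting_operator_sums])
      (simp add: matrix_vector_right_distrib scaleR_right_distrib del: of_nat_Suc)
  show "hitting_operator B i (t *\<^sub>R v) = t *\<^sub>R hitting_operator B i v" for t v
  proof (rule sums_unique2[OF hitting_operator_sums])
    have "(\<lambda>r. real (Suc r) *\<^sub>R site i (oqw_matrix B *v (taboo_step B i ^^ r) (t *\<^sub>R v)))
        = (\<lambda>r. t *\<^sub>R (real (Suc r) *\<^sub>R site i (oqw_matrix B *v (taboo_step B i ^^ r) v)))"
      by (simp add: fun_eq_iff matrix_vector_mul_scaleR del: of_nat_Suc)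
    then show "(\<lambda>r. real (Suc r) *\<^sub>R site i (oqw_matrix B *v (taboo_step B i ^^ r) (t *\<^sub>R v)))
        sums (t *\<^sub>R hitting_operator B i v)"
      using sums_scaleR_right[OF hitting_operator_sums[of v], of t] by (simp only:)
  qed
qed

text \<open>\<open>linear\<close> covers real scalars only; complex ones are moved through the
  series.\<close>

lemma hitting_operator_scale: "hitting_operator B i (c *s v) = cscale c (hitting_operator B i v)"
proof -
  have "bounded_linear (cscale c :: complex^'n^'n \<Rightarrow> complex^'n^'n)"
    using linear_cscale by (simp add: linear_conv_bounded_linear)
  from bounded_linear.sums[OF this hitting_operator_sums[of v]] show ?thesis
    by (intro sums_unique2[OF hitting_operator_sums])
      (simp add: vector_scalar_commute linear_scale[OF linear_cscale] del: of_nat_Suc)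
qed

text \<open>The difference is the distribution at the time of the first visit to \<open>i\<close>, which keeps the
  whole trace because \<open>i\<close> is almost surely visited.\<close>

lemma trace_hitting_operator_taboo_step:
  "trace (hitting_operator B i v) - trace (hitting_operator B i (taboo_step B i v)) = total_trace v"
proof -
  let ?S = "\<lambda>r. (taboo_step B i ^^ r) v"
  define h where "h r = site i (oqw_matrix B *v ?S r)" for r
  have trace_h: "trace (h r) = total_trace (?S r) - total_trace (?S (Suc r))" for r
    by (simp add: h_def total_trace_taboo_step[OF oqw])
  have blt: "bounded_linear (trace :: complex^'n^'n \<Rightarrow> complex)"
    using linear_trace by (simp add: linear_conv_bounded_linear)
  have "(\<lambda>r. real (Suc r) *\<^sub>R h (Suc r)) sums hitting_operator B i (taboo_step B i v)"
    using hitting_operator_sums[of "taboo_step B i v"] by (simp add: h_def funpow_swap1 del: of_nat_Suc)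
  \<comment> \<open>The added term at index 0 has weight 0, so the shift leaves the sum
    unchanged.\<close>
  then have "(\<lambda>r. real r *\<^sub>R h r) sums hitting_operator B i (taboo_step B i v)"
    using sums_Suc_iff[of "\<lambda>r. real r *\<^sub>R h r"] by simp
  \<comment> \<open>The weights r + 1 and r differ by 1, which leaves the unweighted series of
    arrivals.\<close>
  from sums_diff[OF hitting_operator_sums[of v, folded h_def] this]
  have "h sums (hitting_operator B i v - hitting_operator B i (taboo_step B i v))"
    by (simp add: scaleR_left_distrib)
  then have "(\<lambda>r. total_trace (?S r) - total_trace (?S (Suc r)))
      sums trace (hitting_operator B i v - hitting_operator B i (taboo_step B i v))"
    using bounded_linear.sums[OF blt] by (simp only: trace_h[symmetric])
  moreover have "bounded_linear (total_trace :: complex^('k \<times> 'n \<times> 'n) \<Rightarrow> complex)"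
    using linear_total_trace by (simp add: linear_conv_bounded_linear)
  from bounded_linear.tendsto[OF this taboo_power_tendsto_0[of v]]
  have "(\<lambda>r. total_trace (?S r)) \<longlonglongrightarrow> 0"
    by simp
  then have "(\<lambda>r. total_trace (?S r) - total_trace (?S (Suc r))) sums (total_trace (?S 0) - 0)"
    by (rule telescope_sums')
  ultimately have "trace (hitting_operator B i v - hitting_operator B i (taboo_step B i v))
      = total_trace (?S 0) - 0"
    by (rule sums_unique2)
  then show ?thesis
    by (simp add: trace_sub)
qed

text \<open>Let n(v) be the trace of H v minus that of H at the \<open>i\<close>-component of
  \<open>v\<close>. For traceless y, the identity for H y - H (S y) makes the trace of H y equal to
  n(\<Phi> y), so each summand is n(\<Phi> y) - n(y) and the sum telescopes.\<close>

lemma sum_trace_diagonal_hitting_operator: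
  assumes "total_trace x = 0"
  shows "(\<Sum>s<L. trace (hitting_operator B i (place i (site i (matrix_power (oqw_matrix B) s *v x)))))
    = trace (hitting_operator B i (matrix_power (oqw_matrix B) L *v x))
      - trace (hitting_operator B i (place i (site i (matrix_power (oqw_matrix B) L *v x))))
      - (trace (hitting_operator B i x) - trace (hitting_operator B i (place i (site i x))))"
proof (induction L)
  case (Suc L)
  let ?H = "hitting_operator B i" and ?M = "oqw_matrix B"
  let ?y = "matrix_power ?M L *v x"
  have "trace (?H ?y) - trace (?H (taboo_step B i ?y)) = 0"
    by (simp add: trace_hitting_operator_taboo_step total_trace_matrix_power[OF oqw] assms)
  moreover have "?H (taboo_step B i ?y) = ?H (?M *v ?y) - ?H (place i (site i (?M *v ?y)))"
    by (simp only: taboo_step_def linear_diff[OF linear_hitting_operator])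
  ultimately have "trace (?H ?y) = trace (?H (?M *v ?y)) - trace (?H (place i (site i (?M *v ?y))))"
    by (simp only: trace_sub) simp
  moreover have "matrix_power ?M (Suc L) *v x = ?M *v ?y"
    by (simp add: matrix_vector_mul_assoc)
  ultimately show ?case
    by (simp only: sum.lessThan_Suc Suc.IH) simp
qed simp

end

theorem theorem2p7:
  fixes B :: "'k::finite \<Rightarrow> 'k \<Rightarrow> complex^'n::finite^'n"
    and K D N :: "('k, 'n) block_op"
    and p f :: "complex poly"
    and r :: nat
    and a :: "nat \<Rightarrow> complex"
    and T :: "nat \<Rightarrow> 'k \<Rightarrow> 'k \<Rightarrow> complex^'n^'n \<Rightarrow> complex^'n^'n"
  assumes oqw: "is_oqw B"
    and ergodic: "ergodic_oqw B"
    and n_ge_2: "CARD('n) \<ge> 2"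
    and k_ge_2: "CARD('k) \<ge> 2"
    and K: "K = mean_hitting_time B"
    and D: "D = block_diag (\<lambda>i. K i i)"
    and N: "N = block_diff K D"
    and p: "is_minimal_polynomial p (oqw_matrix B)"
    and p_f: "p = [:-1, 1:] * f"
    and r: "r = degree f"
    and f: "f = (\<Sum>l\<le>r. monom (a l) (r - l))"
    and a0: "a 0 = 1"
    and T: "\<And>s i j X. T s i j X =
      block_mult D (block_power (oqw_block B) s) i i X -
      block_mult D (block_power (oqw_block B) s) i j X"
  shows "(\<forall>\<rho> i j. density_matrix \<rho> \<longrightarrow> trace (N i j \<rho>) = trace (\<Sum>s. T s i j \<rho>)) \<and>
    (\<forall>i j X. (\<lambda>s. T s i j X) sums
      cscale (1 / poly f 1) (\<Sum>s<r. \<Sum>l<r - s. cscale (a l) (T s i j X)))"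
proof -
  define W where "W = block_matrix (block_Omega :: ('k, 'n) block_op)"
  \<comment> \<open>\<open>E i\<close> is row \<open>i\<close> of \<open>D\<close> acting on a
    column vector.\<close>
  define E where "E i v = hitting_operator B i (place i (site i v))" for i v
  let ?M = "matrix_power (oqw_matrix B)"
  have linear_H: "linear (hitting_operator B i)" for i
    by (rule linear_hitting_operator[OF oqw ergodic])
  have linear_E: "linear (E i)" for i
    by (rule linearI) (simp_all add: E_def linear_add[OF linear_H] linear_scale[OF linear_H])
  have E_scale: "E i (c *s v) = cscale c (E i v)" for i c v
    by (simp add: E_def hitting_operator_scale[OF oqw ergodic])
  have D_E: "block_mult D A i j X = E i (place i (A i j X))" for A :: "('k, 'n) block_op" and i j X
    by (simp add: block_mult_def D K block_diag_def mean_hitting_time_eq E_def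
        if_distribR cong: if_cong)
  \<comment> \<open>The two blocks in \<open>T\<close> differ only in the starting site, so
    \<open>T\<close> is \<open>E i\<close> along a single orbit.\<close>
  have T_E: "T s i j X = E i (?M s *v (place i X - place j X))" for s i j X
    unfolding T D_E block_power_oqw_block
    by (simp add: E_def matrix_vector_mult_diff_distrib linear_diff[OF linear_H])
  have lim: "?M \<longlonglongrightarrow> W"
    unfolding W_def by (rule ergodic_tendsto[OF ergodic])
  \<comment> \<open>Both placements have the trace of \<open>X\<close>, so their difference is
    traceless.\<close>
  have W_0: "W *v (place i X - place j X) = 0" for i j X
    by (rule vec_eq_siteI) (simp add: W_def site_Omega)
  have sums: "(\<lambda>s. T s i j X) sums
      cscale (1 / poly f 1) (\<Sum>s<r. \<Sum>l<r - s. cscale (a l) (T s i j X))" for i j X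
  proof -
    have "bounded_linear (E i)"
      using linear_E by (simp add: linear_conv_bounded_linear)
    from bounded_linear.sums[OF this orbit_sums_minimal_polynomial[OF lim p p_f f W_0[of i X j]]]
    show ?thesis
      by (simp add: T_E E_scale linear_sum[OF linear_E])
  qed
  have "trace (N i j X) = trace (\<Sum>s. T s i j X)" for i j X
  proof -
    \<comment> \<open>The trace of row \<open>i\<close> of \<open>N\<close> applied to a column
      vector: removing \<open>E i\<close> removes the diagonal block.\<close>
    define n where "n v = trace (hitting_operator B i v) - trace (E i v)" for v
    define x where "x = place i X - place j X"
    have "linear n"
      by (rule linearI) (simp_all add: n_def linear_add[OF linear_H] linear_add[OF linear_E]
          linear_scale[OF linear_H] linear_scale[OF linear_E] trace_add scaleR_right_diff_distrib)
    then have "isCont n 0"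
      by (simp add: linear_conv_bounded_linear linear_continuous_at)
    moreover have "(\<lambda>L. ?M L *v x) \<longlonglongrightarrow> 0"
      using tendsto_matrix_vector_mul_left[OF lim, of x] W_0 by (simp add: x_def)
    ultimately have "(\<lambda>L. n (?M L *v x)) \<longlonglongrightarrow> 0"
      using isCont_tendsto_compose[of 0 n] linear_0[OF \<open>linear n\<close>] by simp
    moreover have "(\<Sum>s<L. trace (T s i j X)) = n (?M L *v x) - n x" for L
      using sum_trace_diagonal_hitting_operator[OF oqw ergodic, where x = x and L = L and i = i]
      by (simp add: T_E x_def n_def E_def)
    ultimately have "(\<lambda>s. trace (T s i j X)) sums (0 - n x)"
      unfolding sums_def by (simp only:) (intro tendsto_diff tendsto_const)
    moreover have "(\<lambda>s. trace (T s i j X)) sums trace (\<Sum>s. T s i j X)"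
      using bounded_linear.sums[OF _ summable_sums[OF sums_summable[OF sums]], of trace] linear_trace
      by (simp add: linear_conv_bounded_linear)
    ultimately have "0 - n x = trace (\<Sum>s. T s i j X)"
      by (rule sums_unique2)
    then have "trace (\<Sum>s. T s i j X) = - n x"
      by simp
    \<comment> \<open>The value \<open>n x\<close> is the trace of \<open>N i i X\<close> minus that
      of \<open>N i j X\<close>, and the diagonal of \<open>N\<close> is zero.\<close>
    also have "\<dots> = trace (N i j X)"
      by (simp add: n_def x_def E_def N block_diff_def K D block_diag_def mean_hitting_time_eq
          site_place linear_diff[OF linear_H] linear_0[OF linear_H] trace_sub)
    finally show ?thesis ..
  qed
  with sums show ?thesis
    by blast
qed

end
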